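(* Suppose that the $p$-structure assumption and the Lipschitz assumption on $\partial\Omega_1,\partial\Omega_2,\Gamma$ hold. Let $s>0$, $\eta_2^0\in D(\mathcal{S}_2)$ and set $u_2^0=F_2\eta_2^0$. Let $(\eta_1^n,\eta_2^n)_{n\ge1}\subset D(\mathcal{S}_1)\times D(\mathcal{S}_2)$ be the Peaceman--Rachford approximation in $L^2(\Gamma)$ given by $$(sI+\mathcal{S}_1)\eta_1^{n+1}=(sI-\mathcal{S}_2)\eta_2^n,\qquad (sI+\mathcal{S}_2)\eta_2^{n+1}=(sI-\mathcal{S}_1)\eta_1^{n+1},\qquad n=0,1,2,\dots$$ Then $(\eta_1^n,\eta_2^n)_{n\ge1}$ also satisfies the weak formulation $$\langle(sJ+S_1)\eta_1^{n+1},\mu\rangle=\langle(sJ-S_2)\eta_2^n,\mu\rangle,\qquad \langle(sJ+S_2)\eta_2^{n+1},\mu\rangle=\langle(sJ-S_1)\eta_1^{n+1},\mu\rangle\qquad\text{for all }\mu\in\Lambda,$$ and $(u_1^n,u_2^n)_{n\ge1}=(F_1\eta_1^n,F_2\eta_2^n)_{n\ge1}\subset V_1\times V_2$ is a weak Robin--Robin approximation, i.e. for $n=0,1,2,\dots$ $$\begin{aligned} &a_1(u_1^{n+1},v_1)=(f_1,v_1)_{L^2(\Omega_1)}\quad\text{for all }v_1\in V_1^0,\\ &a_1(u_1^{n+1},R_1\mu)-(f_1,R_1\mu)_{L^2(\Omega_1)}+a_2(u_2^n,R_2\mu)-(f_2,R_2\mu)_{L^2(\Omega_2)}=s(T_2u_2^n-T_1u_1^{n+1},\mu)_{L^2(\Gamma)}\quad\text{for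 all }\mu\in\Lambda,\\ &a_2(u_2^{n+1},v_2)=(f_2,v_2)_{L^2(\Omega_2)}\quad\text{for all }v_2\in V_2^0,\\ &a_2(u_2^{n+1},R_2\mu)-(f_2,R_2\mu)_{L^2(\Omega_2)}+a_1(u_1^{n+1},R_1\mu)-(f_1,R_1\mu)_{L^2(\Omega_1)}=s(T_1u_1^{n+1}-T_2u_2^{n+1},\mu)_{L^2(\Gamma)}\quad\text{for all }\mu\in\Lambda. \end{aligned}$$
   Context: **Domains and Lipschitz assumption.** $\Omega\subset\mathbb{R}^d$ ($d\ge1$) is a bounded Lipschitz domain and $f\in L^2(\Omega)$. It is decomposed into two nonoverlapping subdomains: $\overline{\Omega}=\overline{\Omega}_1\cup\overline{\Omega}_2$, $\Omega_1\cap\Omega_2=\emptyset$, $\Gamma=(\partial\Omega_1\cap\partial\Omega_2)\setminus\partial\Omega$. The Lipschitz assumption is that $\partial\Omega_1,\partial\Omega_2$ and $\Gamma$ are $(d-1)$-dimensional Lipschitz manifolds, i.e. finite unions of overlapping relatively open sets $\Theta_r$, each of which is, after a coordinate transformation, the graph of a Lipschitz function over a $(d-1)$-dimensional cube $\theta_r$, with charts $\psi_r:\Theta_r\to\theta_r$. Boundary integrals are with respect to surface measure. Write $f_i=f|_{\Omega_i}$. **$p$-structure assumption.** $p\in[2,\infty)$, $r\in(1,\infty)$, and if $p<d$ then $r\le \frac{dp}{2(d-p)}+1$. The functions $\alpha:\mathbb{R}^d\to\mathbb{R}^d$, $g:\mathbb{R}\to\mathbb{R}$ are continuous and for some positive constants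 and all $z,\tilde z\in\mathbb{R}^d$, $x,\tilde x\in\mathbb{R}$: $|\alpha(z)|\le C_1|z|^{p-1}$, $|g(x)|\le C_2|x|^{r-1}$, $(\alpha(z)-\alpha(\tilde z))\cdot(z-\tilde z)\ge c_1|z-\tilde z|^p$, $\alpha(z)\cdot z\ge c_2|z|^p$, $(g(x)-g(\tilde x))(x-\tilde x)\ge c_3|x-\tilde x|^r$, $g(x)x\ge c_4|x|^r$. **Spaces and traces.** For $0<\sigma<1$, $W^{\sigma,p}(\partial\Omega_i)$ consists of $\mu\in L^p(\partial\Omega_i)$ whose local components $\mu\circ\psi_r^{-1}$ lie in the Sobolev--Slobodeckij space $W^{\sigma,p}(\theta_r)$, with norm $(\sum_r\|\mu\circ\psi_r^{-1}\|^p_{W^{\sigma,p}(\theta_r)})^{1/p}$. $T_{\partial\Omega_i}:W^{1,p}(\Omega_i)\to W^{1-1/p,p}(\partial\Omega_i)$ is the bounded surjective trace operator and $R_{\partial\Omega_i}$ a fixed bounded linear right inverse of it. $V_i^0=W_0^{1,p}(\Omega_i)$, $V_i=\{v\in W^{1,p}(\Omega_i):(T_{\partial\Omega_i}v)|_{\partial\Omega_i\setminus\Gamma}=0\}$ with norm $\|v\|_{V_i}=\|\nabla v\|_{L^p(\Omega_i)^d}+\|v\|_{L^r(\Omega_i)}$ (equivalent to the $W^{1,p}(\Omega_i)$-norm). With $E_i\mu$ the extension by zero of $\mu$ from $\Gamma$ to $\partial\Omega_i$: $\Lambda_i=\{\mu\in L^p(\Gamma):E_i\mu\in W^{1-1/p,p}(\partial\Omega_i)\}$,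 $\|\mu\|_{\Lambda_i}=\|E_i\mu\|_{W^{1-1/p,p}(\partial\Omega_i)}$; $\Lambda=\Lambda_1\cap\Lambda_2$, $\|\mu\|_\Lambda=\|\mu\|_{\Lambda_1}+\|\mu\|_{\Lambda_2}$. $T_i:V_i\to\Lambda_i$, $T_iv=(T_{\partial\Omega_i}v)|_\Gamma$; $R_i:\Lambda_i\to V_i$, $R_i\mu=R_{\partial\Omega_i}E_i\mu$. **Steklov--Poincaré operators.** $a_i(u_i,v_i)=\int_{\Omega_i}\alpha(\nabla u_i)\cdot\nabla v_i+g(u_i)v_i\,dx$ for $u_i,v_i\in V_i$. For $\eta\in\Lambda_i$, $F_i\eta\in V_i$ is the unique element with $a_i(F_i\eta,v)=(f_i,v)_{L^2(\Omega_i)}$ for all $v\in V_i^0$ and $T_iF_i\eta=\eta$. $S_i:\Lambda_i\to\Lambda_i^*$, $\langle S_i\eta,\mu\rangle=a_i(F_i\eta,R_i\mu)-(f_i,R_i\mu)_{L^2(\Omega_i)}$. **$L^2(\Gamma)$-operators.** $\Lambda_i$ and $\Lambda$ are dense in $L^2(\Gamma)$, so $L^2(\Gamma)^*\hookrightarrow\Lambda_i^*$, $L^2(\Gamma)^*\hookrightarrow\Lambda^*$; $J:L^2(\Gamma)\to L^2(\Gamma)^*$, $J\mu=(\mu,\cdot)_{L^2(\Gamma)}$, with $\langle J\eta,\mu\rangle=(\eta,\mu)_{L^2(\Gamma)}$ for $\mu\in\Lambda_i$ or $\mu\in\Lambda$. $D(\mathcal{S}_i)=\{\mu\in\Lambda_i:S_i\mu\in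 L^2(\Gamma)^*\}$, $\mathcal{S}_i\mu=J^{-1}S_i\mu$. For $\eta_2^0\in D(\mathcal{S}_2)$ the Peaceman--Rachford iterates in $L^2(\Gamma)$ exist uniquely. *)

theory Defs
  imports "HOL-Analysis.Analysis"
begin

text \<open>
  The space dimension is d = DIM('a). Elements of Lebesgue and Sobolev spaces are represented by
  total functions; equality in these spaces is equality almost everywhere, and values outside the
  set under consideration are irrelevant.
\<close>


section \<open>Lebesgue spaces\<close>

definition Lp :: "real \<Rightarrow> 'a measure \<Rightarrow> ('a \<Rightarrow> 'b::real_normed_vector) set" where
  "Lp p M = {u \<in> borel_measurable M. integrable M (\<lambda>x. norm (u x) powr p)}"

definition Lp_norm :: "real \<Rightarrow> 'a measure \<Rightarrow> ('a \<Rightarrow> 'b::real_normed_vector) \<Rightarrow> real" where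
  "Lp_norm p M u = (\<integral>x. norm (u x) powr p \<partial>M) powr (1 / p)"

definition L2_inner :: "'a measure \<Rightarrow> ('a \<Rightarrow> real) \<Rightarrow> ('a \<Rightarrow> real) \<Rightarrow> real" where
  "L2_inner M u v = (\<integral>x. u x * v x \<partial>M)"


section \<open>Surface measure\<close>

text \<open>
  The \<open>k\<close>-dimensional Hausdorff measure, normalised so that it agrees with Lebesgue measure on
  \<open>k\<close>-dimensional planes. For \<open>k = 0\<close> it is the counting measure (\<open>0 ^ 0 = 1\<close>), whence the separate
  clause for the empty set. The outer measure is metric, so that it is countably additive on the
  Borel sets and the use of \<^const>\<open>measure_of\<close> is legitimate.
\<close>

definition hausdorff_weight :: "nat \<Rightarrow> 'a::euclidean_space set \<Rightarrow> ennreal" where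
  "hausdorff_weight k U =
     (if U = {} then 0 else ennreal (unit_ball_vol (real k) * (diameter U / 2) ^ k))"

definition hausdorff_pre :: "nat \<Rightarrow> real \<Rightarrow> 'a::euclidean_space set \<Rightarrow> ennreal" where
  "hausdorff_pre k \<delta> A =
     (INF U \<in> {U :: nat \<Rightarrow> 'a set. A \<subseteq> (\<Union>n. U n) \<and> (\<forall>n. bounded (U n) \<and> diameter (U n) \<le> \<delta>)}.
        \<Sum>n. hausdorff_weight k (U n))"

definition hausdorff_outer :: "nat \<Rightarrow> 'a::euclidean_space set \<Rightarrow> ennreal" where
  "hausdorff_outer k A = (SUP \<delta> \<in> {0<..}. hausdorff_pre k \<delta> A)"

definition hausdorff_measure :: "nat \<Rightarrow> 'a::euclidean_space measure" where
  "hausdorff_measure k = measure_of UNIV (sets borel) (hausdorff_outer k)"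

definition surface_on :: "'a::euclidean_space set \<Rightarrow> 'a measure" where
  "surface_on M = restrict_space (completion (hausdorff_measure (DIM('a) - 1))) M"


section \<open>Lipschitz manifolds and Lipschitz domains\<close>

text \<open>
  The hyperplane orthogonal to one fixed basis vector plays the role of the \<open>(d-1)\<close>-dimensional
  parameter space.
\<close>

definition vertical :: "'a::euclidean_space" where
  "vertical = (SOME b. b \<in> Basis)"

definition hyperplane_measure :: "'a::euclidean_space measure" where
  "hyperplane_measure =
     distr (\<Pi>\<^sub>M b\<in>Basis - {vertical}. lborel) borel (\<lambda>t. \<Sum>b\<in>Basis - {vertical}. t b *\<^sub>R b)"

text \<open>
  A chart consists of a rigid change of coordinates, half the side length of the cube and the
  Lipschitz function whose graph over the cube is the image of the chart.
\<close>

record 'a chart =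
  motion :: "'a \<Rightarrow> 'a"
  halfside :: real
  graph_fun :: "'a \<Rightarrow> real"

definition cube :: "'a::euclidean_space chart \<Rightarrow> 'a set" where
  "cube c = {y. y \<bullet> vertical = 0 \<and> (\<forall>b\<in>Basis - {vertical}. \<bar>y \<bullet> b\<bar> < halfside c)}"

text \<open>
  The point at signed vertical distance \<open>t\<close> from the graph. For \<open>t = 0\<close> this is the inverse of the
  chart map from the patch to the cube.
\<close>

definition shifted_param :: "'a::euclidean_space chart \<Rightarrow> real \<Rightarrow> 'a \<Rightarrow> 'a" where
  "shifted_param c t y = motion c (y + (graph_fun c y + t) *\<^sub>R vertical)"

definition param :: "'a::euclidean_space chart \<Rightarrow> 'a \<Rightarrow> 'a" where
  "param c = shifted_param c 0"

definition patch :: "'a::euclidean_space chart \<Rightarrow> 'a set" where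
  "patch c = param c ` cube c"

definition lipschitz_chart :: "'a::euclidean_space chart \<Rightarrow> bool" where
  "lipschitz_chart c \<longleftrightarrow>
     (\<exists>z Q. orthogonal_transformation Q \<and> motion c = (\<lambda>x. z + Q x)) \<and>
     halfside c > 0 \<and> (\<exists>L. L-lipschitz_on (cube c) (graph_fun c))"

definition lipschitz_atlas :: "'a::euclidean_space set \<Rightarrow> 'a chart set \<Rightarrow> bool" where
  "lipschitz_atlas M A \<longleftrightarrow>
     finite A \<and> M = (\<Union>c\<in>A. patch c) \<and>
     (\<forall>c\<in>A. lipschitz_chart c \<and> openin (top_of_set M) (patch c))"

definition lipschitz_manifold :: "'a::euclidean_space set \<Rightarrow> bool" where
  "lipschitz_manifold M \<longleftrightarrow> (\<exists>A. lipschitz_atlas M A)"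

definition domain :: "'a::euclidean_space set \<Rightarrow> bool" where
  "domain \<Omega> \<longleftrightarrow> open \<Omega> \<and> connected \<Omega> \<and> \<Omega> \<noteq> {}"

definition bounded_lipschitz_domain :: "'a::euclidean_space set \<Rightarrow> bool" where
  "bounded_lipschitz_domain \<Omega> \<longleftrightarrow>
     domain \<Omega> \<and> bounded \<Omega> \<and>
     (\<exists>A h. lipschitz_atlas (frontier \<Omega>) A \<and> h > 0 \<and>
        (\<forall>c\<in>A. \<forall>y\<in>cube c. \<forall>t.
           (0 < t \<and> t < h \<longrightarrow> shifted_param c t y \<in> \<Omega>) \<and>
           (- h < t \<and> t < 0 \<longrightarrow> shifted_param c t y \<notin> closure \<Omega>)))"


section \<open>Sobolev spaces on domains\<close>

coinductive smooth :: "('a::euclidean_space \<Rightarrow> real) \<Rightarrow> bool" where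
  "(\<forall>x. (\<phi> has_derivative D x) (at x)) \<Longrightarrow> (\<forall>h. smooth (\<lambda>x. D x h)) \<Longrightarrow> smooth \<phi>"

definition test_functions :: "'a::euclidean_space set \<Rightarrow> ('a \<Rightarrow> real) set" where
  "test_functions \<Omega> = {\<phi>. smooth \<phi> \<and> (\<exists>K. compact K \<and> K \<subseteq> \<Omega> \<and> (\<forall>x. x \<notin> K \<longrightarrow> \<phi> x = 0))}"

definition has_weak_gradient ::
  "'a::euclidean_space set \<Rightarrow> ('a \<Rightarrow> real) \<Rightarrow> ('a \<Rightarrow> 'a) \<Rightarrow> bool" where
  "has_weak_gradient \<Omega> u G \<longleftrightarrow>
     u \<in> borel_measurable (lebesgue_on \<Omega>) \<and> G \<in> borel_measurable (lebesgue_on \<Omega>) \<and>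
     (\<forall>K. compact K \<and> K \<subseteq> \<Omega> \<longrightarrow> integrable (lebesgue_on K) u \<and> integrable (lebesgue_on K) G) \<and>
     (\<forall>\<phi>\<in>test_functions \<Omega>. \<forall>b\<in>Basis.
        (\<integral>x. u x * frechet_derivative \<phi> (at x) b \<partial>lebesgue_on \<Omega>) =
        - (\<integral>x. (G x \<bullet> b) * \<phi> x \<partial>lebesgue_on \<Omega>))"

definition weak_gradient :: "'a::euclidean_space set \<Rightarrow> ('a \<Rightarrow> real) \<Rightarrow> 'a \<Rightarrow> 'a" where
  "weak_gradient \<Omega> u = (SOME G. has_weak_gradient \<Omega> u G)"

definition W1p :: "real \<Rightarrow> 'a::euclidean_space set \<Rightarrow> ('a \<Rightarrow> real) set" where
  "W1p p \<Omega> =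
     {u \<in> Lp p (lebesgue_on \<Omega>). \<exists>G. has_weak_gradient \<Omega> u G \<and> G \<in> Lp p (lebesgue_on \<Omega>)}"

definition W1p_norm :: "real \<Rightarrow> 'a::euclidean_space set \<Rightarrow> ('a \<Rightarrow> real) \<Rightarrow> real" where
  "W1p_norm p \<Omega> u =
     (Lp_norm p (lebesgue_on \<Omega>) u powr p +
      Lp_norm p (lebesgue_on \<Omega>) (weak_gradient \<Omega> u) powr p) powr (1 / p)"

definition W1p_0 :: "real \<Rightarrow> 'a::euclidean_space set \<Rightarrow> ('a \<Rightarrow> real) set" where
  "W1p_0 p \<Omega> =
     {u \<in> W1p p \<Omega>. \<exists>\<phi> :: nat \<Rightarrow> 'a \<Rightarrow> real. (\<forall>n. \<phi> n \<in> test_functions \<Omega>) \<and>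
        (\<lambda>n. W1p_norm p \<Omega> (\<lambda>x. u x - \<phi> n x)) \<longlonglongrightarrow> 0}"


section \<open>Sobolev--Slobodeckij spaces on the boundary\<close>

definition cube_measure :: "'a::euclidean_space chart \<Rightarrow> 'a measure" where
  "cube_measure c = restrict_space (completion hyperplane_measure) (cube c)"

definition slobodeckij_quotient :: "real \<Rightarrow> real \<Rightarrow> ('a::euclidean_space \<Rightarrow> real) \<Rightarrow> 'a \<times> 'a \<Rightarrow> real" where
  "slobodeckij_quotient \<sigma> p u =
     (\<lambda>(x, y). \<bar>u x - u y\<bar> powr p / dist x y powr (real (DIM('a) - 1) + \<sigma> * p))"

definition Wsp_cube :: "real \<Rightarrow> real \<Rightarrow> 'a::euclidean_space chart \<Rightarrow> ('a \<Rightarrow> real) set" where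
  "Wsp_cube \<sigma> p c =
     {u \<in> Lp p (cube_measure c).
        integrable (cube_measure c \<Otimes>\<^sub>M cube_measure c) (slobodeckij_quotient \<sigma> p u)}"

definition Wsp_cube_norm :: "real \<Rightarrow> real \<Rightarrow> 'a::euclidean_space chart \<Rightarrow> ('a \<Rightarrow> real) \<Rightarrow> real" where
  "Wsp_cube_norm \<sigma> p c u =
     (Lp_norm p (cube_measure c) u powr p +
      (\<integral>z. slobodeckij_quotient \<sigma> p u z \<partial>(cube_measure c \<Otimes>\<^sub>M cube_measure c))) powr (1 / p)"

text \<open>\<open>A\<close> is the atlas of the manifold \<open>M\<close> used to define the space and its norm.\<close>

definition Wsp ::
  "real \<Rightarrow> real \<Rightarrow> 'a::euclidean_space set \<Rightarrow> 'a chart set \<Rightarrow> ('a \<Rightarrow> real) set" where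
  "Wsp \<sigma> p M A = {\<mu> \<in> Lp p (surface_on M). \<forall>c\<in>A. \<mu> \<circ> param c \<in> Wsp_cube \<sigma> p c}"

definition Wsp_norm :: "real \<Rightarrow> real \<Rightarrow> 'a::euclidean_space chart set \<Rightarrow> ('a \<Rightarrow> real) \<Rightarrow> real" where
  "Wsp_norm \<sigma> p A \<mu> = (\<Sum>c\<in>A. Wsp_cube_norm \<sigma> p c (\<mu> \<circ> param c) powr p) powr (1 / p)"


section \<open>Traces\<close>

text \<open>
  The trace operator is the continuous extension to \<open>W1p\<close> of the restriction of smooth functions to
  the boundary.
\<close>

definition has_trace ::
  "real \<Rightarrow> 'a::euclidean_space set \<Rightarrow> ('a \<Rightarrow> real) \<Rightarrow> ('a \<Rightarrow> real) \<Rightarrow> bool" where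
  "has_trace p \<Omega> v \<mu> \<longleftrightarrow>
     \<mu> \<in> Lp p (surface_on (frontier \<Omega>)) \<and>
     (\<exists>\<phi> :: nat \<Rightarrow> 'a \<Rightarrow> real. (\<forall>n. smooth (\<phi> n)) \<and>
        (\<lambda>n. W1p_norm p \<Omega> (\<lambda>x. v x - \<phi> n x)) \<longlonglongrightarrow> 0 \<and>
        (\<lambda>n. Lp_norm p (surface_on (frontier \<Omega>)) (\<lambda>x. \<mu> x - \<phi> n x)) \<longlonglongrightarrow> 0)"

definition trace :: "real \<Rightarrow> 'a::euclidean_space set \<Rightarrow> ('a \<Rightarrow> real) \<Rightarrow> 'a \<Rightarrow> real" where
  "trace p \<Omega> v = (SOME \<mu>. has_trace p \<Omega> v \<mu>)"

definition bounded_trace_right_inverse ::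
  "real \<Rightarrow> 'a::euclidean_space set \<Rightarrow> 'a chart set \<Rightarrow> (('a \<Rightarrow> real) \<Rightarrow> 'a \<Rightarrow> real) \<Rightarrow> bool" where
  "bounded_trace_right_inverse p \<Omega> A R \<longleftrightarrow>
     (let X = Wsp (1 - 1 / p) p (frontier \<Omega>) A in
       (\<forall>\<mu>\<in>X. R \<mu> \<in> W1p p \<Omega> \<and> (AE x in surface_on (frontier \<Omega>). trace p \<Omega> (R \<mu>) x = \<mu> x)) \<and>
       (\<forall>\<mu>\<in>X. \<forall>\<nu>\<in>X. \<forall>a b.
          AE x in lebesgue_on \<Omega>. R (\<lambda>x. a * \<mu> x + b * \<nu> x) x = a * R \<mu> x + b * R \<nu> x) \<and>
       (\<exists>K. \<forall>\<mu>\<in>X. W1p_norm p \<Omega> (R \<mu>) \<le> K * Wsp_norm (1 - 1 / p) p A \<mu>))"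

definition V_space :: "real \<Rightarrow> 'a::euclidean_space set \<Rightarrow> 'a set \<Rightarrow> ('a \<Rightarrow> real) set" where
  "V_space p \<Omega> \<Gamma> =
     {v \<in> W1p p \<Omega>. AE x in surface_on (frontier \<Omega> - \<Gamma>). trace p \<Omega> v x = 0}"

definition interface_trace ::
  "real \<Rightarrow> 'a::euclidean_space set \<Rightarrow> 'a set \<Rightarrow> ('a \<Rightarrow> real) \<Rightarrow> 'a \<Rightarrow> real" where
  "interface_trace p \<Omega> \<Gamma> v = restrict (trace p \<Omega> v) \<Gamma>"

definition ext_zero :: "'a set \<Rightarrow> ('a \<Rightarrow> real) \<Rightarrow> 'a \<Rightarrow> real" where
  "ext_zero \<Gamma> \<mu> = (\<lambda>x. if x \<in> \<Gamma> then \<mu> x else 0)"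

definition Lambda_space ::
  "real \<Rightarrow> 'a::euclidean_space set \<Rightarrow> 'a chart set \<Rightarrow> 'a set \<Rightarrow> ('a \<Rightarrow> real) set" where
  "Lambda_space p \<Omega> A \<Gamma> =
     {\<mu> \<in> Lp p (surface_on \<Gamma>). ext_zero \<Gamma> \<mu> \<in> Wsp (1 - 1 / p) p (frontier \<Omega>) A}"


section \<open>The nonlinear equation and the Steklov--Poincar\'e operators\<close>

definition p_structure ::
  "real \<Rightarrow> real \<Rightarrow> ('a::euclidean_space \<Rightarrow> 'a) \<Rightarrow> (real \<Rightarrow> real) \<Rightarrow> bool" where
  "p_structure p r \<alpha> g \<longleftrightarrow>
     2 \<le> p \<and> 1 < r \<and>
     (p < real DIM('a) \<longrightarrow> r \<le> real DIM('a) * p / (2 * (real DIM('a) - p)) + 1) \<and>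
     continuous_on UNIV \<alpha> \<and> continuous_on UNIV g \<and>
     (\<exists>C1>0. \<exists>C2>0. \<exists>c1>0. \<exists>c2>0. \<exists>c3>0. \<exists>c4>0.
        (\<forall>z. norm (\<alpha> z) \<le> C1 * norm z powr (p - 1)) \<and>
        (\<forall>x. \<bar>g x\<bar> \<le> C2 * \<bar>x\<bar> powr (r - 1)) \<and>
        (\<forall>z z'. (\<alpha> z - \<alpha> z') \<bullet> (z - z') \<ge> c1 * norm (z - z') powr p) \<and>
        (\<forall>z. \<alpha> z \<bullet> z \<ge> c2 * norm z powr p) \<and>
        (\<forall>x x'. (g x - g x') * (x - x') \<ge> c3 * \<bar>x - x'\<bar> powr r) \<and>
        (\<forall>x. g x * x \<ge> c4 * \<bar>x\<bar> powr r))"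

definition a_form ::
  "('a::euclidean_space \<Rightarrow> 'a) \<Rightarrow> (real \<Rightarrow> real) \<Rightarrow> 'a set \<Rightarrow> ('a \<Rightarrow> real) \<Rightarrow> ('a \<Rightarrow> real) \<Rightarrow> real" where
  "a_form \<alpha> g \<Omega> u v =
     (\<integral>x. \<alpha> (weak_gradient \<Omega> u x) \<bullet> weak_gradient \<Omega> v x + g (u x) * v x \<partial>lebesgue_on \<Omega>)"

text \<open>
  \<open>F\<close> is the solution operator with data on the interface. By strict monotonicity, \<open>F \<eta>\<close> is determined
  up to null sets by the following conditions, so uniqueness is not imposed separately.
\<close>

definition solution_operator ::
  "real \<Rightarrow> ('a::euclidean_space \<Rightarrow> 'a) \<Rightarrow> (real \<Rightarrow> real) \<Rightarrow> ('a \<Rightarrow> real) \<Rightarrow> 'a set \<Rightarrow> 'a chart set \<Rightarrow>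
   'a set \<Rightarrow> (('a \<Rightarrow> real) \<Rightarrow> 'a \<Rightarrow> real) \<Rightarrow> bool" where
  "solution_operator p \<alpha> g f \<Omega> A \<Gamma> F \<longleftrightarrow>
     (\<forall>\<eta>\<in>Lambda_space p \<Omega> A \<Gamma>.
        F \<eta> \<in> V_space p \<Omega> \<Gamma> \<and>
        (\<forall>v\<in>W1p_0 p \<Omega>. a_form \<alpha> g \<Omega> (F \<eta>) v = L2_inner (lebesgue_on \<Omega>) f v) \<and>
        (AE x in surface_on \<Gamma>. interface_trace p \<Omega> \<Gamma> (F \<eta>) x = \<eta> x))"

definition steklov_poincare ::
  "('a::euclidean_space \<Rightarrow> 'a) \<Rightarrow> (real \<Rightarrow> real) \<Rightarrow> ('a \<Rightarrow> real) \<Rightarrow> 'a set \<Rightarrow>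
   (('a \<Rightarrow> real) \<Rightarrow> 'a \<Rightarrow> real) \<Rightarrow> (('a \<Rightarrow> real) \<Rightarrow> 'a \<Rightarrow> real) \<Rightarrow> ('a \<Rightarrow> real) \<Rightarrow> ('a \<Rightarrow> real) \<Rightarrow> real" where
  "steklov_poincare \<alpha> g f \<Omega> F R \<eta> \<mu> =
     a_form \<alpha> g \<Omega> (F \<eta>) (R \<mu>) - L2_inner (lebesgue_on \<Omega>) f (R \<mu>)"


section \<open>Operators on \<open>L\<^sup>2(\<Gamma>)\<close>\<close>

definition J_op :: "'a::euclidean_space set \<Rightarrow> ('a \<Rightarrow> real) \<Rightarrow> ('a \<Rightarrow> real) \<Rightarrow> real" where
  "J_op \<Gamma> \<eta> \<mu> = L2_inner (surface_on \<Gamma>) \<eta> \<mu>"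

definition L2_dual :: "'a::euclidean_space set \<Rightarrow> (('a \<Rightarrow> real) \<Rightarrow> real) set" where
  "L2_dual \<Gamma> =
     {l. (\<forall>u\<in>Lp 2 (surface_on \<Gamma>). \<forall>v\<in>Lp 2 (surface_on \<Gamma>). \<forall>a b.
            l (\<lambda>x. a * u x + b * v x) = a * l u + b * l v) \<and>
         (\<exists>K. \<forall>u\<in>Lp 2 (surface_on \<Gamma>). \<bar>l u\<bar> \<le> K * Lp_norm 2 (surface_on \<Gamma>) u)}"

text \<open>
  A functional on \<open>L\<close>, which is dense in the square-integrable functions on \<open>\<Gamma>\<close>, belongs to the dual
  of the latter space if it is the restriction of a bounded linear functional.
\<close>

definition L2_domain ::
  "'a::euclidean_space set \<Rightarrow> ('a \<Rightarrow> real) set \<Rightarrow> (('a \<Rightarrow> real) \<Rightarrow> ('a \<Rightarrow> real) \<Rightarrow> real) \<Rightarrow>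
   ('a \<Rightarrow> real) set" where
  "L2_domain \<Gamma> L S = {\<eta> \<in> L. \<exists>l\<in>L2_dual \<Gamma>. \<forall>\<mu>\<in>L. S \<eta> \<mu> = l \<mu>}"

definition L2_op ::
  "'a::euclidean_space set \<Rightarrow> ('a \<Rightarrow> real) set \<Rightarrow> (('a \<Rightarrow> real) \<Rightarrow> ('a \<Rightarrow> real) \<Rightarrow> real) \<Rightarrow>
   ('a \<Rightarrow> real) \<Rightarrow> 'a \<Rightarrow> real" where
  "L2_op \<Gamma> L S \<eta> = (SOME w. w \<in> Lp 2 (surface_on \<Gamma>) \<and> (\<forall>\<mu>\<in>L. J_op \<Gamma> w \<mu> = S \<eta> \<mu>))"

end

theory Submission
  imports Defs
begin

text \<open>
  Testing the strong iteration with \<open>\<mu> \<in> \<Lambda>\<close> in \<open>L\<^sup>2(\<Gamma>)\<close> gives the weak one, and inserting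
  \<open>\<eta>\<^sub>i = T\<^sub>i u\<^sub>i\<close> and the definition of \<open>S\<^sub>i\<close> turns the weak one into the Robin conditions. This requires
  that \<open>J\<^sup>-\<^sup>1 S\<^sub>i \<eta>\<close> exists on the domain of the \<open>L\<^sup>2(\<Gamma>)\<close>-operator, which is the Riesz representation
  theorem, and that \<open>\<Lambda>\<^sub>i \<subseteq> L\<^sup>2(\<Gamma>)\<close>, which follows from \<open>p \<ge> 2\<close> since a Lipschitz manifold with
  finite atlas has finite surface measure.
\<close>


section \<open>Square-integrable functions\<close>

lemma Lp_2_iff:
  fixes u :: "'a \<Rightarrow> real"
  shows "u \<in> Lp 2 M \<longleftrightarrow> u \<in> borel_measurable M \<and> integrable M (\<lambda>x. (u x)\<^sup>2)"
  by (simp add: Lp_def)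

lemma Lp_2_mult_integrable:
  fixes u v :: "'a \<Rightarrow> real"
  assumes "u \<in> Lp 2 M" "v \<in> Lp 2 M"
  shows "integrable M (\<lambda>x. u x * v x)"
proof (rule Bochner_Integration.integrable_bound)
  show "integrable M (\<lambda>x. (u x)\<^sup>2 + (v x)\<^sup>2)"
    using assms by (simp add: Lp_2_iff)
  show "(\<lambda>x. u x * v x) \<in> borel_measurable M"
    using assms by (auto simp: Lp_2_iff)
  have "\<bar>a * b\<bar> \<le> a\<^sup>2 + b\<^sup>2" for a b :: real
    using sum_squares_bound[of a b] sum_squares_bound[of a "-b"] by (auto simp: abs_if)
  then show "AE x in M. norm (u x * v x) \<le> norm ((u x)\<^sup>2 + (v x)\<^sup>2)"
    by simp
qed

lemma Lp_2_lincomb: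
  fixes u v :: "'a \<Rightarrow> real"
  assumes "u \<in> Lp 2 M" "v \<in> Lp 2 M"
  shows "(\<lambda>x. a * u x + b * v x) \<in> Lp 2 M"
proof -
  have eq: "(\<lambda>x. (a * u x + b * v x)\<^sup>2) =
      (\<lambda>x. a\<^sup>2 * (u x)\<^sup>2 + (2 * a * b) * (u x * v x) + b\<^sup>2 * (v x)\<^sup>2)"
    by (rule ext) (simp add: power2_eq_square algebra_simps)
  show ?thesis
    unfolding Lp_2_iff eq using assms Lp_2_mult_integrable[OF assms]
    by (auto simp: Lp_2_iff)
qed

lemma Lp_2_lincomb_square_integral:
  fixes u v :: "'a \<Rightarrow> real"
  assumes "u \<in> Lp 2 M" "v \<in> Lp 2 M"
  shows "(\<integral>x. (a * u x + b * v x)\<^sup>2 \<partial>M) =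
    a\<^sup>2 * (\<integral>x. (u x)\<^sup>2 \<partial>M) + 2 * a * b * (\<integral>x. u x * v x \<partial>M) + b\<^sup>2 * (\<integral>x. (v x)\<^sup>2 \<partial>M)"
proof -
  have eq: "(\<lambda>x. (a * u x + b * v x)\<^sup>2) =
      (\<lambda>x. a\<^sup>2 * (u x)\<^sup>2 + (2 * a * b) * (u x * v x) + b\<^sup>2 * (v x)\<^sup>2)"
    by (rule ext) (simp add: power2_eq_square algebra_simps)
  show ?thesis
    unfolding eq using assms Lp_2_mult_integrable[OF assms]
    by (simp add: Lp_2_iff)
qed

text \<open>Riesz-Fischer for sequences with a prescribed geometric rate. The increments decay fast
  enough almost everywhere for the telescoping series to converge pointwise, and Fatou's lemma
  carries the rate over to the limit.\<close>

lemma Lp_2_complete: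
  fixes u :: "nat \<Rightarrow> 'a \<Rightarrow> real"
  assumes u: "\<And>n. u n \<in> Lp 2 M"
    and cauchy: "\<And>m n. n \<le> m \<Longrightarrow> (\<integral>x. (u m x - u n x)\<^sup>2 \<partial>M) \<le> C * (1 / 16) ^ n"
  obtains w where "w \<in> Lp 2 M" "\<And>n. (\<integral>x. (u n x - w x)\<^sup>2 \<partial>M) \<le> C * (1 / 16) ^ n"
proof -
  have [measurable]: "u n \<in> borel_measurable M" for n
    using u by (simp add: Lp_2_iff)
  have diff: "(\<lambda>x. u m x - u n x) \<in> Lp 2 M" for m n
    using Lp_2_lincomb[OF u u, of 1 m "-1" n] by simp
  have int: "integrable M (\<lambda>x. (u m x - u n x)\<^sup>2)" for m n
    using diff by (simp add: Lp_2_iff)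
  have nn: "(\<integral>\<^sup>+x. ennreal ((u m x - u n x)\<^sup>2) \<partial>M) \<le> ennreal (C * (1 / 16) ^ n)" if "n \<le> m" for m n
    using cauchy[OF that] nn_integral_eq_integral[OF int] by (simp add: ennreal_leI)
  have C: "C \<ge> 0"
    using cauchy[of 0 0] by simp
  \<comment> \<open>The weight \<open>4 ^ n\<close> splits the rate 1/16: the integrals of
    \<open>D n\<close> are still summable, being at most C / 4^n, while a bound on
    \<open>D n x\<close> uniform in n forces increments of order 1/2^n at x.\<close>
  define D where "D n x = 4 ^ n * (u (Suc n) x - u n x)\<^sup>2" for n x
  have "(\<integral>\<^sup>+x. (\<Sum>n. ennreal (D n x)) \<partial>M) = (\<Sum>n. \<integral>\<^sup>+x. ennreal (D n x) \<partial>M)"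
    by (rule nn_integral_suminf) (simp add: D_def)
  also have "\<dots> \<le> (\<Sum>n. ennreal (C * (1 / 4) ^ n))"
  proof (rule suminf_le)
    fix n
    have "(\<integral>\<^sup>+x. ennreal (D n x) \<partial>M) = ennreal (4 ^ n) * (\<integral>\<^sup>+x. ennreal ((u (Suc n) x - u n x)\<^sup>2) \<partial>M)"
      by (simp add: D_def ennreal_mult nn_integral_cmult)
    also have "\<dots> \<le> ennreal (4 ^ n) * ennreal (C * (1 / 16) ^ n)"
      by (intro mult_left_mono nn) auto
    also have "\<dots> = ennreal (C * (1 / 4) ^ n)"
      using C by (simp add: ennreal_mult[symmetric] power_mult_distrib[symmetric] mult.left_commute)
    finally show "(\<integral>\<^sup>+x. ennreal (D n x) \<partial>M) \<le> ennreal (C * (1 / 4) ^ n)" .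
  qed auto
  also have "\<dots> = ennreal (\<Sum>n. C * (1 / 4) ^ n)"
    using C by (intro suminf_ennreal2 summable_mult summable_geometric) auto
  finally have "(\<integral>\<^sup>+x. (\<Sum>n. ennreal (D n x)) \<partial>M) < \<infinity>"
    by (rule order.strict_trans1) simp
  then have fin: "AE x in M. (\<Sum>n. ennreal (D n x)) \<noteq> \<infinity>"
    by (intro nn_integral_PInf_AE) (auto simp: D_def)
  have conv: "AE x in M. convergent (\<lambda>n. u n x)"
    using fin
  proof eventually_elim
    case (elim x)
    have "summable (\<lambda>n. D n x)"
      using elim by (intro summable_suminf_not_top) (auto simp: D_def)
    \<comment> \<open>Summability enters only through the boundedness of the terms; the square root
      of the bound gives a geometric majorant of the increments.\<close>
    then have "Bseq (\<lambda>n. D n x)"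
      by (intro convergent_imp_Bseq) (auto dest: summable_LIMSEQ_zero simp: convergent_def)
    then obtain B where B: "B > 0" "\<And>n. D n x \<le> B"
      by (auto simp: Bseq_def D_def)
    have "summable (\<lambda>n. u (Suc n) x - u n x)"
    proof (rule summable_comparison_test')
      show "summable (\<lambda>n. sqrt B * (1 / 2) ^ n)"
        by (intro summable_mult summable_geometric) auto
      fix n :: nat
      have "(2 ^ n * (u (Suc n) x - u n x))\<^sup>2 \<le> B"
        using B(2)[of n] power_mult[of "2 :: real" n 2] power_mult[of "2 :: real" 2 n]
        by (simp add: D_def power_mult_distrib mult.commute)
      then have "\<bar>2 ^ n * (u (Suc n) x - u n x)\<bar> \<le> sqrt B"
        using real_le_rsqrt by (metis power2_abs)
      then have "2 ^ n * \<bar>u (Suc n) x - u n x\<bar> \<le> sqrt B"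
        by (simp add: abs_mult)
      then show "norm (u (Suc n) x - u n x) \<le> sqrt B * (1 / 2) ^ n"
        by (simp add: power_divide pos_le_divide_eq mult.commute)
    qed
    then show ?case
      using telescope_summable[of "\<lambda>n. u n x"] 
      by (metis (no_types, lifting) convergent_def summable_LIMSEQ sum_lessThan_telescope summable_iff_convergent
          convergent_diff_const_right_iff ext)
  qed
  \<comment> \<open>\<open>lim\<close> is total, so \<open>w\<close> is measurable on the whole
    space; its values on the null set of divergence are immaterial.\<close>
  define w where "w x = lim (\<lambda>n. u n x)" for x
  have w[measurable]: "w \<in> borel_measurable M"
    unfolding w_def by measurable
  have lim: "AE x in M. (\<lambda>n. u n x) \<longlonglongrightarrow> w x"
    using conv by eventually_elim (simp add: w_def convergent_LIMSEQ_iff)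
  \<comment> \<open>Fatou with n fixed and m tending to infinity: the integrand is almost everywhere
    the limit of the squared differences, and the assumed bound holds for all m \<ge> n.\<close>
  have bound: "(\<integral>\<^sup>+x. ennreal ((u n x - w x)\<^sup>2) \<partial>M) \<le> ennreal (C * (1 / 16) ^ n)" for n
  proof -
    have "(\<integral>\<^sup>+x. ennreal ((u n x - w x)\<^sup>2) \<partial>M) =
        (\<integral>\<^sup>+x. liminf (\<lambda>m. ennreal ((u m x - u n x)\<^sup>2)) \<partial>M)"
    proof (rule nn_integral_cong_AE, use lim in eventually_elim)
      case (elim x)
      have "(\<lambda>m. ennreal ((u m x - u n x)\<^sup>2)) \<longlonglongrightarrow> ennreal ((w x - u n x)\<^sup>2)"
        by (intro tendsto_intros elim)
      from lim_imp_Liminf[OF _ this] show ?case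
        by (simp add: power2_commute)
    qed
    also have "\<dots> \<le> liminf (\<lambda>m. \<integral>\<^sup>+x. ennreal ((u m x - u n x)\<^sup>2) \<partial>M)"
      by (intro nn_integral_liminf) auto
    also have "\<dots> \<le> ennreal (C * (1 / 16) ^ n)"
      by (rule Liminf_le) (auto intro!: eventually_sequentiallyI[of n] nn)
    finally show ?thesis .
  qed
  have wn: "(\<lambda>x. u n x - w x) \<in> Lp 2 M" for n
    unfolding Lp_2_iff
    using le_less_trans[OF bound] by (auto intro!: integrableI_nonneg)
  show ?thesis
  proof
    \<comment> \<open>Written as w = u_0 - (u_0 - w), a difference of two elements of the
      space.\<close>
    show "w \<in> Lp 2 M"
      using Lp_2_lincomb[OF u[of 0] wn[of 0], of 1 "-1"] by simp
    show "(\<integral>x. (u n x - w x)\<^sup>2 \<partial>M) \<le> C * (1 / 16) ^ n" for n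
      using bound[of n] C nn_integral_eq_integral[of M "\<lambda>x. (u n x - w x)\<^sup>2"] wn[of n]
      by (simp add: Lp_2_iff)
  qed
qed

section \<open>Riesz representation by minimising a quadratic functional\<close>

lemma linear_quadratic_nonneg_imp_zero:
  fixes a q :: real
  assumes "q \<ge> 0" "\<And>t. 2 * t * a + 2 * t\<^sup>2 * q \<ge> 0"
  shows "a = 0"
proof -
  \<comment> \<open>For small t of sign opposite to a the linear term would win. Using q + 1 instead
    of q keeps the denominator positive when q = 0 and leaves a negative remainder.\<close>
  have "2 * (- a / (q + 1)) * a + 2 * (- a / (q + 1))\<^sup>2 * q = - 2 * a\<^sup>2 / (q + 1)\<^sup>2"
    using assms(1) by (simp add: divide_simps power2_eq_square) (simp add: algebra_simps)
  then have "2 * a\<^sup>2 / (q + 1)\<^sup>2 \<le> 0"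
    using assms(2)[of "- a / (q + 1)"] by simp
  then show ?thesis
    using assms(1) by (simp add: divide_le_0_iff)
qed

text \<open>
  The representing function is the minimiser of \<open>\<parallel>u\<parallel>\<^sup>2 - 2 l(u)\<close>; by the parallelogram identity
  minimising sequences are Cauchy.
\<close>

lemma riesz_representation_Lp_2:
  fixes l :: "('a \<Rightarrow> real) \<Rightarrow> real"
  assumes lin: "\<And>u v a b. u \<in> Lp 2 M \<Longrightarrow> v \<in> Lp 2 M \<Longrightarrow>
      l (\<lambda>x. a * u x + b * v x) = a * l u + b * l v"
    and bdd: "\<And>u. u \<in> Lp 2 M \<Longrightarrow> \<bar>l u\<bar> \<le> K * Lp_norm 2 M u"
  shows "\<exists>w\<in>Lp 2 M. \<forall>v\<in>Lp 2 M. (\<integral>x. w x * v x \<partial>M) = l v"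
proof -
  define Q where "Q u = (\<integral>x. (u x)\<^sup>2 \<partial>M)" for u :: "'a \<Rightarrow> real"
  define E where "E u = Q u - 2 * l u" for u
  define m where "m = Inf (E ` Lp 2 M)"
  have Q0: "Q u \<ge> 0" for u
    by (simp add: Q_def)
  have "(\<lambda>x. 0 :: real) \<in> Lp 2 M"
    by (simp add: Lp_2_iff)
  then have ne: "E ` Lp 2 M \<noteq> {}"
    by blast
  \<comment> \<open>With |u| the L^2 norm, E u \<ge> |u|^2 - 2 K |u| = (|u| - K)^2 - K^2.\<close>
  have "- K\<^sup>2 \<le> E u" if "u \<in> Lp 2 M" for u
  proof -
    have "Lp_norm 2 M u = sqrt (Q u)"
      using Q0[of u] by (simp add: Lp_norm_def Q_def powr_half_sqrt)
    then have "l u \<le> K * sqrt (Q u)"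
      using bdd[OF that] by simp
    moreover have "0 \<le> (sqrt (Q u) - K)\<^sup>2"
      by simp
    ultimately show ?thesis
      using Q0[of u] by (simp add: E_def power2_diff algebra_simps)
  qed
  then have below: "bdd_below (E ` Lp 2 M)"
    by (auto intro!: bdd_belowI2)
  have mE: "m \<le> E u" if "u \<in> Lp 2 M" for u
    unfolding m_def using below that by (auto intro: cInf_lower)
  \<comment> \<open>The accuracy 1/16^n is chosen to match the rate in
    \<open>Lp_2_complete\<close>.\<close>
  have "\<exists>u\<in>Lp 2 M. E u < m + (1 / 16) ^ n" for n :: nat
    using cInf_lessD[OF ne, of "m + (1 / 16) ^ n"] by (auto simp: m_def)
  then obtain u where u: "\<And>n. u n \<in> Lp 2 M" and uE: "\<And>n. E (u n) < m + (1 / 16) ^ n"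
    by metis
  \<comment> \<open>Since l is linear, it cancels in the parallelogram identity: the squared
    distance equals 2 E(u_k) + 2 E(u_n) - 4 E(midpoint). The midpoint value is at least m, so
    near-minimality leaves 2/16^k + 2/16^n, hence the constant 4.\<close>
  have cauchy: "(\<integral>x. (u k x - u n x)\<^sup>2 \<partial>M) \<le> 4 * (1 / 16) ^ n" if "n \<le> k" for k n
  proof -
    let ?h = "\<lambda>x. (1 / 2) * u k x + (1 / 2) * u n x"
    have "Q ?h = Q (u k) / 4 + (\<integral>x. u k x * u n x \<partial>M) / 2 + Q (u n) / 4"
      using Lp_2_lincomb_square_integral[OF u u, of "1/2" k "1/2" n]
      by (simp add: Q_def power2_eq_square)
    moreover have "l ?h = l (u k) / 2 + l (u n) / 2"
      using lin[OF u u, of "1/2" k "1/2" n] by simp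
    moreover have "(\<integral>x. (u k x - u n x)\<^sup>2 \<partial>M) = Q (u k) - 2 * (\<integral>x. u k x * u n x \<partial>M) + Q (u n)"
      using Lp_2_lincomb_square_integral[OF u u, of 1 k "-1" n] by (simp add: Q_def)
    ultimately have "(\<integral>x. (u k x - u n x)\<^sup>2 \<partial>M) = 2 * E (u k) + 2 * E (u n) - 4 * E ?h"
      by (simp add: E_def algebra_simps)
    moreover have "m \<le> E ?h"
      by (intro mE Lp_2_lincomb u)
    moreover have "(1 / 16 :: real) ^ k \<le> (1 / 16) ^ n"
      using that by (intro power_decreasing) auto
    ultimately show ?thesis
      using uE[of k] uE[of n] by linarith
  qed
  obtain w where w: "w \<in> Lp 2 M" and wn: "\<And>n. (\<integral>x. (u n x - w x)\<^sup>2 \<partial>M) \<le> 4 * (1 / 16) ^ n"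
    using Lp_2_complete[OF u cauchy] by blast
  show ?thesis
  proof (intro bexI[OF _ w] ballI)
    fix v :: "'a \<Rightarrow> real" assume v: "v \<in> Lp 2 M"
    \<comment> \<open>First variation at w. The minimality of w is not established separately: u_n +
      t v is compared with the infimum and n tends to infinity. One summand t^2 Q(v) comes from
      expanding E, the other from Young's inequality for the cross term of u_n - w and t v.\<close>
    have "2 * t * ((\<integral>x. w x * v x \<partial>M) - l v) + 2 * t\<^sup>2 * Q v \<ge> 0" for t
    proof -
      let ?I = "2 * t * ((\<integral>x. w x * v x \<partial>M) - l v) + 2 * t\<^sup>2 * Q v"
      \<comment> \<open>The error is 1/16^n from near-minimality of u_n plus 4/16^n from its squared
        distance to w.\<close>
      have "- 5 * (1 / 16) ^ n \<le> ?I" for n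
      proof -
        have d: "(\<lambda>x. u n x - w x) \<in> Lp 2 M"
          using Lp_2_lincomb[OF u w, of 1 n "-1"] by simp
        have "m \<le> E (\<lambda>x. 1 * u n x + t * v x)"
          by (intro mE Lp_2_lincomb u v)
        also have "\<dots> = E (u n) + 2 * t * ((\<integral>x. u n x * v x \<partial>M) - l v) + t\<^sup>2 * Q v"
          using Lp_2_lincomb_square_integral[OF u v, of 1 n t] lin[OF u v, of 1 n t]
          by (simp add: E_def Q_def algebra_simps)
        finally have 1: "- ((1 / 16) ^ n) \<le> 2 * t * ((\<integral>x. u n x * v x \<partial>M) - l v) + t\<^sup>2 * Q v"
          using uE[of n] by simp
        have 2: "0 \<le> (\<integral>x. (u n x - w x)\<^sup>2 \<partial>M) - 2 * t * (\<integral>x. (u n x - w x) * v x \<partial>M) + t\<^sup>2 * Q v"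
          using Lp_2_lincomb_square_integral[OF d v, of 1 "-t"] Q0[of "\<lambda>x. 1 * (u n x - w x) + - t * v x"]
          by (simp add: Q_def)
        have 3: "(\<integral>x. (u n x - w x) * v x \<partial>M) = (\<integral>x. u n x * v x \<partial>M) - (\<integral>x. w x * v x \<partial>M)"
          using Lp_2_mult_integrable[OF u v] Lp_2_mult_integrable[OF w v]
          by (simp add: left_diff_distrib)
        show ?thesis
          using 1 2[unfolded 3] wn[of n] by (simp add: algebra_simps)
      qed
      moreover have "(\<lambda>n. - 5 * (1 / 16) ^ n :: real) \<longlonglongrightarrow> - 5 * 0"
        by (intro tendsto_intros LIMSEQ_realpow_zero) auto
      ultimately show ?thesis
        using LIMSEQ_le_const2[of _ "- 5 * 0" ?I] by auto
    qed
    from linear_quadratic_nonneg_imp_zero[OF Q0 this] show "(\<integral>x. w x * v x \<partial>M) = l v"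
      by simp
  qed
qed

section \<open>Finiteness of the surface measure\<close>

lemma hausdorff_pre_le_finite_cover:
  fixes U :: "'i \<Rightarrow> 'a::euclidean_space set"
  assumes "finite I" "A \<subseteq> (\<Union>i\<in>I. U i)" "\<delta> > 0"
    and "\<And>i. i \<in> I \<Longrightarrow> bounded (U i) \<and> diameter (U i) \<le> \<delta>"
  shows "hausdorff_pre k \<delta> A \<le> (\<Sum>i\<in>I. hausdorff_weight k (U i))"
proof -
  obtain e where e: "bij_betw e {..<card I} I"
    using ex_bij_betw_nat_finite[OF assms(1)] by (auto simp: atLeast0LessThan)
  \<comment> \<open>Padding to a sequence with empty sets is free: their weight is 0 for every k,
    including k = 0, by the separate clause in \<open>hausdorff_weight\<close>.\<close>
  define V where "V n = (if n < card I then U (e n) else {})" for n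
  have V: "A \<subseteq> (\<Union>n. V n)"
  proof
    fix x assume "x \<in> A"
    then obtain i where "i \<in> I" "x \<in> U i"
      using assms(2) by blast
    moreover from \<open>i \<in> I\<close> have "i \<in> e ` {..<card I}"
      using e by (simp add: bij_betw_imp_surj_on)
    then obtain n where "n < card I" "i = e n"
      by blast
    ultimately show "x \<in> (\<Union>n. V n)"
      by (auto simp: V_def)
  qed
  have "e n \<in> I" if "n < card I" for n
    using e that by (auto simp: bij_betw_def)
  then have "bounded (V n) \<and> diameter (V n) \<le> \<delta>" for n
    using assms(3,4) by (auto simp: V_def)
  then have "hausdorff_pre k \<delta> A \<le> (\<Sum>n. hausdorff_weight k (V n))"
    unfolding hausdorff_pre_def using V by (intro INF_lower) auto
  also have "\<dots> = (\<Sum>n<card I. hausdorff_weight k (V n))"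
    by (rule suminf_finite) (auto simp: V_def hausdorff_weight_def)
  also have "\<dots> = (\<Sum>n<card I. hausdorff_weight k (U (e n)))"
    by (simp add: V_def)
  also have "\<dots> = (\<Sum>i\<in>I. hausdorff_weight k (U i))"
    using e by (rule sum.reindex_bij_betw)
  finally show ?thesis .
qed

section \<open>Covering Lipschitz graphs by small cells\<close>

lemma vertical_in_Basis: "(vertical :: 'a::euclidean_space) \<in> Basis"
  unfolding vertical_def by (rule someI_ex) (use nonempty_Basis in blast)

text \<open>The translation cancels and Q is an isometry, so only the lift to the graph can stretch
  distances, and it contributes at most L times the distance in the cube.\<close>

lemma dist_param_le:
  fixes c :: "'a::euclidean_space chart"
  assumes "orthogonal_transformation Q" "motion c = (\<lambda>x. z + Q x)"
    and "L-lipschitz_on (cube c) (graph_fun c)" "x \<in> cube c" "y \<in> cube c"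
  shows "dist (param c x) (param c y) \<le> (1 + L) * dist x y"
proof -
  let ?g = "graph_fun c"
  have "param c x - param c y = Q ((x - y) + (?g x - ?g y) *\<^sub>R vertical)"
    using assms(1,2)
    by (simp add: param_def shifted_param_def orthogonal_transformation_def linear_diff[symmetric]
        algebra_simps)
  then have "dist (param c x) (param c y) = norm ((x - y) + (?g x - ?g y) *\<^sub>R vertical)"
    using assms(1) by (simp add: dist_norm orthogonal_transformation_norm)
  also have "\<dots> \<le> norm (x - y) + \<bar>?g x - ?g y\<bar>"
    using norm_triangle_ineq[of "x - y" "(?g x - ?g y) *\<^sub>R vertical"] norm_Basis[OF vertical_in_Basis, where 'a='a]
    by simp
  also have "\<bar>?g x - ?g y\<bar> \<le> L * dist x y"
    using lipschitz_onD[OF assms(3-5)] by (simp add: dist_real_def)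
  finally show ?thesis
    by (simp add: dist_norm algebra_simps)
qed

text \<open>
  The cells \<open>j \<in> {..<N}\<^sup>k\<close> of the cube, \<open>k = d - 1\<close>, have diameter of order \<open>1 / N\<close>, whence the sum of
  their weights is bounded independently of \<open>N\<close>.
\<close>

lemma lipschitz_chart_cells:
  fixes c :: "'a::euclidean_space chart"
  assumes "lipschitz_chart c"
  shows "\<exists>K\<ge>0. \<forall>N>0. \<exists>U :: ('a \<Rightarrow> nat) \<Rightarrow> 'a set.
    patch c \<subseteq> (\<Union>j\<in>PiE (Basis - {vertical}) (\<lambda>_. {..<N}). U j) \<and>
    (\<forall>j. bounded (U j) \<and> diameter (U j) \<le> K / real N)"
proof -
  obtain z Q L where Q: "orthogonal_transformation Q" "motion c = (\<lambda>x. z + Q x)"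
    and h: "halfside c > 0" and L: "L-lipschitz_on (cube c) (graph_fun c)"
    using assms unfolding lipschitz_chart_def by blast
  define B where "B = Basis - {vertical :: 'a}"
  define h where "h = halfside c"
  \<comment> \<open>A cell has side 2 h / N, so its diameter is at most d times that by comparison
    with the l1 norm; 1 + L is the Lipschitz constant of \<open>param c\<close>.\<close>
  define K where "K = (1 + L) * (real DIM('a) * (2 * h))"
  have L0: "L \<ge> 0"
    using L by (simp add: lipschitz_on_def)
  have h0: "h > 0"
    using h by (simp add: h_def)
  show ?thesis
  proof (intro exI[of _ K] conjI allI impI)
    show "K \<ge> 0"
      using L0 h0 by (simp add: K_def)
    fix N :: nat assume N: "N > 0"
    \<comment> \<open>Cells are closed relative to the cube and may share faces; only the covering
      property and the diameter matter.\<close>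
    define C where "C j = {y \<in> cube c. \<forall>b\<in>B.
      2 * h / N * real (j b) \<le> y \<bullet> b + h \<and> y \<bullet> b + h \<le> 2 * h / N * (real (j b) + 1)}" for j
    have sub: "cube c \<subseteq> (\<Union>j\<in>PiE B (\<lambda>_. {..<N}). C j)"
    proof
      fix y assume y: "y \<in> cube c"
      \<comment> \<open>The coordinate measured in cell widths from the face at -h. As the cube is
        open, it is below N, so its floor is an admissible index.\<close>
      define q where "q b = (y \<bullet> b + h) * N / (2 * h)" for b
      define j where "j = restrict (\<lambda>b. nat \<lfloor>q b\<rfloor>) B"
      have q: "0 \<le> q b \<and> q b < N" if "b \<in> B" for b
      proof -
        have "\<bar>y \<bullet> b\<bar> < h"
          using y that by (auto simp: cube_def B_def h_def)
        then have "0 < y \<bullet> b + h" "y \<bullet> b + h < 2 * h"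
          by auto
        then show ?thesis
          using h0 N by (auto simp: q_def pos_divide_less_eq intro: less_imp_le)
      qed
      have "j \<in> PiE B (\<lambda>_. {..<N})"
        using q by (force simp: j_def nat_less_iff floor_less_iff)
      moreover have "y \<in> C j"
        unfolding C_def
      proof (intro CollectI conjI ballI y)
        fix b assume b: "b \<in> B"
        have e: "y \<bullet> b + h = 2 * h / N * q b"
          using h0 N by (simp add: q_def)
        have f: "real (j b) \<le> q b" "q b \<le> real (j b) + 1"
          using q[OF b] b by (auto simp: j_def)
        show "2 * h / N * real (j b) \<le> y \<bullet> b + h"
          unfolding e using f h0 by (intro mult_left_mono) auto
        show "y \<bullet> b + h \<le> 2 * h / N * (real (j b) + 1)"
          unfolding e using f h0 by (intro mult_left_mono) auto
      qed
      ultimately show "y \<in> (\<Union>j\<in>PiE B (\<lambda>_. {..<N}). C j)"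
        by blast
    qed
    have dist: "dist (param c x) (param c y) \<le> K / N" if xy: "x \<in> C j" "y \<in> C j" for x y j
    proof -
      have cube: "x \<in> cube c" "y \<in> cube c"
        using xy by (auto simp: C_def)
      \<comment> \<open>The vertical coordinates both vanish on the cube; the others lie in a common
        interval of length 2 h / N.\<close>
      have "\<bar>(x - y) \<bullet> b\<bar> \<le> 2 * h / N" if "b \<in> Basis" for b
      proof (cases "b = vertical")
        case True
        then show ?thesis
          using cube h0 by (simp add: cube_def inner_diff_left)
      next
        case False
        then have b: "b \<in> B"
          using that by (simp add: B_def)
        have "2 * h / N * real (j b) \<le> x \<bullet> b + h" "x \<bullet> b + h \<le> 2 * h / N * real (j b) + 2 * h / N"
          "2 * h / N * real (j b) \<le> y \<bullet> b + h" "y \<bullet> b + h \<le> 2 * h / N * real (j b) + 2 * h / N"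
          using xy b by (auto simp: C_def distrib_left)
        then show ?thesis
          unfolding inner_diff_left by linarith
      qed
      then have "(\<Sum>b\<in>Basis. \<bar>(x - y) \<bullet> b\<bar>) \<le> real DIM('a) * (2 * h / N)"
        by (rule sum_bounded_above)
      then have "dist x y \<le> real DIM('a) * (2 * h / N)"
        using norm_le_l1[of "x - y"] by (simp add: dist_norm)
      then have "(1 + L) * dist x y \<le> (1 + L) * (real DIM('a) * (2 * h / N))"
        using L0 by (intro mult_left_mono) auto
      also have "\<dots> = K / N"
        by (simp add: K_def)
      finally show ?thesis
        using dist_param_le[OF Q L cube] by simp
    qed
    show "\<exists>U :: ('a \<Rightarrow> nat) \<Rightarrow> 'a set.
      patch c \<subseteq> (\<Union>j\<in>PiE (Basis - {vertical}) (\<lambda>_. {..<N}). U j) \<and>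
      (\<forall>j. bounded (U j) \<and> diameter (U j) \<le> K / real N)"
    proof (intro exI[of _ "\<lambda>j. param c ` C j"] conjI allI)
      show "patch c \<subseteq> (\<Union>j\<in>PiE (Basis - {vertical}) (\<lambda>_. {..<N}). param c ` C j)"
        using sub unfolding patch_def B_def by blast
      show "bounded (param c ` C j)" for j
        unfolding bounded_two_points using dist by blast
      show "diameter (param c ` C j) \<le> K / real N" for j
        using dist \<open>K \<ge> 0\<close> by (intro diameter_le) (auto simp: dist_norm)
    qed
  qed
qed

text \<open>Each patch is covered by N^k cells of weight at most a constant times 1/N^k. The total
  is bounded independently of N, hence of \<delta>, and the bound survives the supremum over
  \<delta>.\<close>

lemma hausdorff_outer_lipschitz_manifold_finite:
  fixes M :: "'a::euclidean_space set"
  assumes "lipschitz_manifold M"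
  shows "hausdorff_outer (DIM('a) - 1) M < \<infinity>"
proof -
  define k where "k = DIM('a) - 1"
  obtain A where A: "finite A" "M = (\<Union>c\<in>A. patch c)" "\<And>c. c \<in> A \<Longrightarrow> lipschitz_chart c"
    using assms unfolding lipschitz_manifold_def lipschitz_atlas_def by blast
  define cells where "cells N = PiE (Basis - {vertical :: 'a}) (\<lambda>_. {..<N::nat})" for N
  have finite: "finite (cells N)" for N
    by (auto simp: cells_def intro!: finite_PiE)
  have card: "card (cells N) = N ^ k" for N
    using vertical_in_Basis[where 'a='a] by (simp add: cells_def card_PiE k_def card_Diff_singleton)
  define covers where "covers c K N U \<longleftrightarrow> patch c \<subseteq> (\<Union>j\<in>cells N. U j) \<and>
      (\<forall>j. bounded (U j) \<and> diameter (U j) \<le> K / real N)"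
    for c and K :: real and N and U :: "('a \<Rightarrow> nat) \<Rightarrow> 'a set"
  have "\<forall>c\<in>A. \<exists>K\<ge>0. \<forall>N>0. \<exists>U. covers c K N U"
    using lipschitz_chart_cells A(3) unfolding covers_def cells_def by blast
  then obtain K where K: "\<And>c. c \<in> A \<Longrightarrow> K c \<ge> 0"
    and "\<And>c N. c \<in> A \<Longrightarrow> N > 0 \<Longrightarrow> \<exists>U. covers c (K c) N U"
    by metis
  then obtain V where "\<And>c N. c \<in> A \<Longrightarrow> N > 0 \<Longrightarrow> covers c (K c) N (V c N)"
    by metis
  then have V: "\<And>c N. c \<in> A \<Longrightarrow> N > 0 \<Longrightarrow> patch c \<subseteq> (\<Union>j\<in>cells N. V c N j)"
    "\<And>c N j. c \<in> A \<Longrightarrow> N > 0 \<Longrightarrow> bounded (V c N j) \<and> diameter (V c N j) \<le> K c / real N"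
    unfolding covers_def by blast+
  define W where "W = (\<Sum>c\<in>A. ennreal (unit_ball_vol (real k) * (K c / 2) ^ k))"
  have "hausdorff_pre k \<delta> M \<le> W" if "\<delta> > 0" for \<delta>
  proof -
    \<comment> \<open>The sum of the \<open>K c\<close> dominates each of them, so one N makes the
      cells of all patches smaller than \<delta>; the maximum with 0 ensures N > 0.\<close>
    obtain N :: nat where N: "N > 0" "(\<Sum>c\<in>A. K c) / \<delta> < N"
      using reals_Archimedean2[of "max 0 ((\<Sum>c\<in>A. K c) / \<delta>)"] by auto
    have small: "K c / N \<le> \<delta>" if "c \<in> A" for c
    proof -
      have "K c \<le> (\<Sum>c\<in>A. K c)"
        using A(1) K that by (intro member_le_sum) auto
      also have "\<dots> \<le> \<delta> * N"
        using N(2) \<open>\<delta> > 0\<close> by (simp add: field_simps)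
      finally show ?thesis
        using N(1) by (simp add: field_simps)
    qed
    have "hausdorff_pre k \<delta> M \<le> (\<Sum>(c, j)\<in>A \<times> cells N. hausdorff_weight k (V c N j))"
      unfolding case_prod_beta
    proof (rule hausdorff_pre_le_finite_cover)
      show "M \<subseteq> (\<Union>i\<in>A \<times> cells N. V (fst i) N (snd i))"
        using V(1)[OF _ N(1)] unfolding A(2) by fastforce
      show "bounded (V (fst i) N (snd i)) \<and> diameter (V (fst i) N (snd i)) \<le> \<delta>"
        if "i \<in> A \<times> cells N" for i
        using V(2)[OF _ N(1)] small that order_trans by (metis mem_Times_iff)
    qed (use A(1) finite \<open>\<delta> > 0\<close> in auto)
    also have "\<dots> = (\<Sum>c\<in>A. \<Sum>j\<in>cells N. hausdorff_weight k (V c N j))"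
      by (simp add: sum.cartesian_product)
    also have "\<dots> \<le> W"
      unfolding W_def
    proof (rule sum_mono)
      fix c assume c: "c \<in> A"
      have "hausdorff_weight k (V c N j) \<le> ennreal (unit_ball_vol (real k) * (K c / N / 2) ^ k)" for j
      proof -
        have "(diameter (V c N j) / 2) ^ k \<le> (K c / N / 2) ^ k"
          using V(2)[OF c N(1), of j] diameter_ge_0[of "V c N j"]
          by (intro power_mono divide_right_mono) auto
        then show ?thesis
          by (auto simp: hausdorff_weight_def intro!: ennreal_leI mult_left_mono)
      qed
      then have "(\<Sum>j\<in>cells N. hausdorff_weight k (V c N j)) \<le>
          of_nat (card (cells N)) * ennreal (unit_ball_vol (real k) * (K c / N / 2) ^ k)"
        by (intro sum_bounded_above)
      also have "\<dots> = ennreal (real (N ^ k) * (unit_ball_vol (real k) * (K c / N / 2) ^ k))"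
        using K[OF c] by (simp add: card ennreal_mult ennreal_of_nat_eq_real_of_nat del: of_nat_power)
      \<comment> \<open>The number of cells cancels the scaling of the weights, leaving the term of
        \<open>W\<close>.\<close>
      also have "real (N ^ k) * (unit_ball_vol (real k) * (K c / N / 2) ^ k) =
          unit_ball_vol (real k) * (K c / 2) ^ k"
        using N(1) by (simp add: power_divide)
      finally show "(\<Sum>j\<in>cells N. hausdorff_weight k (V c N j)) \<le>
          ennreal (unit_ball_vol (real k) * (K c / 2) ^ k)" .
    qed
    finally show ?thesis .
  qed
  then have "hausdorff_outer k M \<le> W"
    unfolding hausdorff_outer_def by (intro SUP_least) auto
  also have "W < \<infinity>"
    unfolding W_def using K by (subst sum_ennreal) auto
  finally show ?thesis
    by (simp add: k_def)
qed

lemma finite_measure_surface_on: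
  fixes M :: "'a::euclidean_space set"
  assumes "lipschitz_manifold M" "M \<in> sets borel"
  shows "finite_measure (surface_on M)"
proof
  let ?H = "hausdorff_measure (DIM('a) - 1) :: 'a measure"
  have sets: "sets ?H = sets borel" "space ?H = UNIV"
    using sets.sigma_sets_eq[of "borel :: 'a measure"] by (simp_all add: hausdorff_measure_def)
  have "emeasure (surface_on M) (space (surface_on M)) = emeasure (completion ?H) M"
    using assms(2) sets unfolding surface_on_def
    by (subst emeasure_restrict_space) (auto simp: space_restrict_space)
  also have "\<dots> = emeasure ?H M"
    using assms(2) sets by (simp add: emeasure_completion main_part_sets)
  \<comment> \<open>\<open>measure_of\<close> returns either the given set function or the zero
    measure, and the inequality holds in both cases.\<close>
  also have "\<dots> \<le> hausdorff_outer (DIM('a) - 1) M"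
    by (simp add: hausdorff_measure_def emeasure_measure_of_conv)
  also have "\<dots> < \<infinity>"
    by (rule hausdorff_outer_lipschitz_manifold_finite[OF assms(1)])
  finally show "emeasure (surface_on M) (space (surface_on M)) \<noteq> \<infinity>"
    by simp
qed

section \<open>Embedding of L^p into L^2 on a finite measure space\<close>

lemma Lp_subset_Lp_2:
  assumes "finite_measure M" "p \<ge> 2"
  shows "Lp p M \<subseteq> (Lp 2 M :: ('a \<Rightarrow> 'b::real_normed_vector) set)"
proof
  interpret finite_measure M by fact
  fix u :: "'a \<Rightarrow> 'b" assume u: "u \<in> Lp p M"
  then have [measurable]: "u \<in> borel_measurable M"
    by (simp add: Lp_def)
  have "integrable M (\<lambda>x. norm (u x) powr 2)"
  proof (rule Bochner_Integration.integrable_bound)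
    show "integrable M (\<lambda>x. 1 + norm (u x) powr p)"
      using u by (simp add: Lp_def)
    \<comment> \<open>Large values are controlled by the p-th power as p \<ge> 2, small ones by the
      constant 1, which is integrable since the measure is finite.\<close>
    have "t powr 2 \<le> 1 + t powr p" if "t \<ge> 0" for t :: real
    proof (cases "t \<ge> 1")
      case True
      then have "t powr 2 \<le> t powr p"
        using assms(2) by (intro powr_mono) auto
      then show ?thesis by simp
    next
      case False
      then have "t powr 2 \<le> 1"
        using that by (intro powr_le1) auto
      then show ?thesis
        by (simp add: add_increasing2)
    qed
    then show "AE x in M. norm (norm (u x) powr 2) \<le> norm (1 + norm (u x) powr p)"
      by simp
  qed measurable
  then show "u \<in> Lp 2 M"
    by (simp add: Lp_def)
qed

section \<open>Measurability under changes on null sets\<close>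

lemma (in complete_measure) borel_measurable_cong_AE:
  assumes "AE x in M. u x = v x" "v \<in> measurable M N" "u \<in> space M \<rightarrow> space N"
  shows "u \<in> measurable M N"
proof (rule measurableI)
  fix A assume "A \<in> sets N"
  show "u -` A \<inter> space M \<in> sets M"
  proof (rule in_sets_AE)
    show "v -` A \<inter> space M \<in> sets M"
      using assms(2) \<open>A \<in> sets N\<close> by (rule measurable_sets)
    show "AE x in M. (x \<in> v -` A \<inter> space M) = (x \<in> u -` A \<inter> space M)"
      using assms(1) by eventually_elim auto
  qed auto
qed (use assms(3) in auto)

text \<open>Traces are known only almost everywhere on the interface; completeness of the surface
  measure makes them measurable there, as the change of integrand under the integral
  requires.\<close>

lemma borel_measurable_surface_on_cong_AE:
  fixes M :: "'a::euclidean_space set" and u v :: "'a \<Rightarrow> real"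
  assumes "M \<in> sets borel" "AE x in surface_on M. u x = v x" "v \<in> borel_measurable (surface_on M)"
  shows "u \<in> borel_measurable (surface_on M)"
proof -
  let ?H = "completion (hausdorff_measure (DIM('a) - 1) :: 'a measure)"
  have M: "M \<in> sets ?H" "M \<inter> space ?H \<in> sets ?H"
    using assms(1) sets.sigma_sets_eq[of "borel :: 'a measure"] by (auto simp: hausdorff_measure_def)
  \<comment> \<open>Extension by zero moves the question from the restricted space to the completed
    measure on the whole space.\<close>
  have "(\<lambda>x. indicator M x *\<^sub>R u x) \<in> borel_measurable ?H"
  proof (rule completion.borel_measurable_cong_AE)
    show "AE x in ?H. indicator M x *\<^sub>R u x = indicator M x *\<^sub>R v x"
      using assms(2) M unfolding surface_on_def by (auto simp: AE_restrict_space_iff)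
    show "(\<lambda>x. indicator M x *\<^sub>R v x) \<in> borel_measurable ?H"
      using assms(3) M unfolding surface_on_def by (simp add: borel_measurable_restrict_space_iff)
  qed simp
  then show ?thesis
    using M unfolding surface_on_def by (simp add: borel_measurable_restrict_space_iff)
qed

section \<open>The iteration in its strong and weak form\<close>

text \<open>Riesz applied to the bounded extension of \<open>S \<eta>\<close> supplies a candidate
  for the choice in \<open>L2_op\<close>, so the chosen function has the defining
  properties.\<close>

lemma L2_op_represents:
  assumes "L \<subseteq> Lp 2 (surface_on \<Gamma>)" "\<eta> \<in> L2_domain \<Gamma> L S"
  shows "L2_op \<Gamma> L S \<eta> \<in> Lp 2 (surface_on \<Gamma>)"
    and "\<And>\<mu>. \<mu> \<in> L \<Longrightarrow> J_op \<Gamma> (L2_op \<Gamma> L S \<eta>) \<mu> = S \<eta> \<mu>"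
proof -
  obtain l where l: "l \<in> L2_dual \<Gamma>" "\<forall>\<mu>\<in>L. S \<eta> \<mu> = l \<mu>"
    using assms(2) unfolding L2_domain_def by blast
  from l(1) obtain K where "\<And>u. u \<in> Lp 2 (surface_on \<Gamma>) \<Longrightarrow> \<bar>l u\<bar> \<le> K * Lp_norm 2 (surface_on \<Gamma>) u"
    unfolding L2_dual_def by blast
  with l(1) have "\<exists>w\<in>Lp 2 (surface_on \<Gamma>). \<forall>v\<in>Lp 2 (surface_on \<Gamma>). (\<integral>x. w x * v x \<partial>surface_on \<Gamma>) = l v"
    unfolding L2_dual_def by (intro riesz_representation_Lp_2) auto
  then have "\<exists>w. w \<in> Lp 2 (surface_on \<Gamma>) \<and> (\<forall>\<mu>\<in>L. J_op \<Gamma> w \<mu> = S \<eta> \<mu>)"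
    using assms(1) l(2) unfolding J_op_def L2_inner_def by (metis subsetD)
  from someI_ex[OF this]
  show "L2_op \<Gamma> L S \<eta> \<in> Lp 2 (surface_on \<Gamma>)"
    and "\<And>\<mu>. \<mu> \<in> L \<Longrightarrow> J_op \<Gamma> (L2_op \<Gamma> L S \<eta>) \<mu> = S \<eta> \<mu>"
    unfolding L2_op_def by blast+
qed

lemma L2_inner_lincomb_left:
  assumes "u \<in> Lp 2 M" "v \<in> Lp 2 M" "\<mu> \<in> Lp 2 M"
  shows "L2_inner M (\<lambda>x. a * u x + b * v x) \<mu> = a * L2_inner M u \<mu> + b * L2_inner M v \<mu>"
  using Lp_2_mult_integrable[OF assms(1,3)] Lp_2_mult_integrable[OF assms(2,3)]
  by (simp add: L2_inner_def distrib_right mult.assoc)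

lemma L2_inner_cong_AE:
  assumes "AE x in M. u x = v x" "u \<in> borel_measurable M" "v \<in> borel_measurable M"
    "\<mu> \<in> borel_measurable M"
  shows "L2_inner M u \<mu> = L2_inner M v \<mu>"
  unfolding L2_inner_def using assms by (intro integral_cong_AE) auto

text \<open>Multiply the pointwise identity by \<mu> and integrate. \<mu> must lie in both spaces
  because each operator is represented only against its own. The two spaces and operators are kept
  generic so that both half steps are instances.\<close>

lemma peaceman_rachford_step_weak:
  assumes L: "L1 \<subseteq> Lp 2 (surface_on \<Gamma>)" "L2 \<subseteq> Lp 2 (surface_on \<Gamma>)"
    and dom: "\<eta> \<in> L2_domain \<Gamma> L1 S1" "\<zeta> \<in> L2_domain \<Gamma> L2 S2"
    and step: "AE x in surface_on \<Gamma>.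
      s * \<eta> x + L2_op \<Gamma> L1 S1 \<eta> x = s * \<zeta> x - L2_op \<Gamma> L2 S2 \<zeta> x"
    and \<mu>: "\<mu> \<in> L1" "\<mu> \<in> L2"
  shows "s * J_op \<Gamma> \<eta> \<mu> + S1 \<eta> \<mu> = s * J_op \<Gamma> \<zeta> \<mu> - S2 \<zeta> \<mu>"
proof -
  let ?M = "surface_on \<Gamma>" and ?w = "L2_op \<Gamma> L1 S1 \<eta>" and ?z = "L2_op \<Gamma> L2 S2 \<zeta>"
  have "\<eta> \<in> L1" "\<zeta> \<in> L2"
    using dom by (simp_all add: L2_domain_def)
  with L \<mu> have mem: "\<eta> \<in> Lp 2 ?M" "\<zeta> \<in> Lp 2 ?M" "?w \<in> Lp 2 ?M" "?z \<in> Lp 2 ?M" "\<mu> \<in> Lp 2 ?M"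
    using L2_op_represents(1)[OF L(1) dom(1)] L2_op_represents(1)[OF L(2) dom(2)] by blast+
  have "L2_inner ?M (\<lambda>x. s * \<eta> x + 1 * ?w x) \<mu> = L2_inner ?M (\<lambda>x. s * \<zeta> x + (- 1) * ?z x) \<mu>"
  proof (rule L2_inner_cong_AE)
    show "AE x in ?M. s * \<eta> x + 1 * ?w x = s * \<zeta> x + (- 1) * ?z x"
      using step by simp
  qed (use mem in \<open>auto simp: Lp_2_iff\<close>)
  then have "s * L2_inner ?M \<eta> \<mu> + L2_inner ?M ?w \<mu> = s * L2_inner ?M \<zeta> \<mu> - L2_inner ?M ?z \<mu>"
    using L2_inner_lincomb_left[OF mem(1,3,5), of s 1] L2_inner_lincomb_left[OF mem(2,4,5), of s "-1"]
    by simp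
  then show ?thesis
    using L2_op_represents(2)[OF L(1) dom(1) \<mu>(1)] L2_op_represents(2)[OF L(2) dom(2) \<mu>(2)]
    by (simp add: J_op_def)
qed

text \<open>Converts the jump of the traces on the right of the Robin conditions into the terms with
  J of the weak iteration.\<close>

lemma L2_inner_surface_diff_cong_AE:
  fixes \<Gamma> :: "'a::euclidean_space set" and u v :: "'a \<Rightarrow> real"
  assumes "\<Gamma> \<in> sets borel" "\<eta> \<in> Lp 2 (surface_on \<Gamma>)" "\<zeta> \<in> Lp 2 (surface_on \<Gamma>)"
    and "AE x in surface_on \<Gamma>. u x = \<eta> x" "AE x in surface_on \<Gamma>. v x = \<zeta> x"
    and "\<mu> \<in> Lp 2 (surface_on \<Gamma>)"
  shows "L2_inner (surface_on \<Gamma>) (\<lambda>x. u x - v x) \<mu> = J_op \<Gamma> \<eta> \<mu> - J_op \<Gamma> \<zeta> \<mu>"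
proof -
  let ?M = "surface_on \<Gamma>"
  have meas: "\<eta> \<in> borel_measurable ?M" "\<zeta> \<in> borel_measurable ?M" "\<mu> \<in> borel_measurable ?M"
    using assms by (auto simp: Lp_2_iff)
  have "L2_inner ?M (\<lambda>x. u x - v x) \<mu> = L2_inner ?M (\<lambda>x. 1 * \<eta> x + (- 1) * \<zeta> x) \<mu>"
  proof (rule L2_inner_cong_AE)
    show "AE x in ?M. u x - v x = 1 * \<eta> x + (- 1) * \<zeta> x"
      using assms(4,5) by eventually_elim simp
    show "(\<lambda>x. u x - v x) \<in> borel_measurable ?M"
      using borel_measurable_surface_on_cong_AE[OF assms(1)] assms(4,5) meas
      by (intro borel_measurable_diff) blast+
  qed (use meas in auto)
  also have "\<dots> = J_op \<Gamma> \<eta> \<mu> - J_op \<Gamma> \<zeta> \<mu>"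
    using L2_inner_lincomb_left[OF assms(2,3,6), of 1 "-1"] by (simp add: J_op_def)
  finally show ?thesis .
qed

section \<open>Weak Peaceman-Rachford iteration and Robin-Robin conditions\<close>

theorem corollary8p6:
  fixes \<Omega> \<Omega>1 \<Omega>2 \<Gamma> :: "'a::euclidean_space set"
    and A1 A2 :: "'a chart set"
    and f :: "'a \<Rightarrow> real" and \<alpha> :: "'a \<Rightarrow> 'a" and g :: "real \<Rightarrow> real"
    and p r s :: real
    and RB1 RB2 R1 R2 F1 F2 T1 T2 :: "('a \<Rightarrow> real) \<Rightarrow> 'a \<Rightarrow> real"
    and \<Lambda>1 \<Lambda>2 \<Lambda> :: "('a \<Rightarrow> real) set"
    and S1 S2 :: "('a \<Rightarrow> real) \<Rightarrow> ('a \<Rightarrow> real) \<Rightarrow> real"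
    and a1 a2 ip1 ip2 ip\<Gamma> J :: "('a \<Rightarrow> real) \<Rightarrow> ('a \<Rightarrow> real) \<Rightarrow> real"
    and \<eta>1 \<eta>2 u1 u2 :: "nat \<Rightarrow> 'a \<Rightarrow> real"
  assumes domain: "bounded_lipschitz_domain \<Omega>" "f \<in> Lp 2 (lebesgue_on \<Omega>)"
    and subdomains: "domain \<Omega>1" "domain \<Omega>2" "\<Omega>1 \<subseteq> \<Omega>" "\<Omega>2 \<subseteq> \<Omega>"
    and decomposition: "closure \<Omega> = closure \<Omega>1 \<union> closure \<Omega>2" "\<Omega>1 \<inter> \<Omega>2 = {}"
    and interface: "\<Gamma> = (frontier \<Omega>1 \<inter> frontier \<Omega>2) - frontier \<Omega>"
    and lipschitz: "lipschitz_atlas (frontier \<Omega>1) A1" "lipschitz_atlas (frontier \<Omega>2) A2"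
      "lipschitz_manifold \<Gamma>"
    and p_struct: "p_structure p r \<alpha> g"
    and right_inverses: "bounded_trace_right_inverse p \<Omega>1 A1 RB1"
      "bounded_trace_right_inverse p \<Omega>2 A2 RB2"
    and solution_operators: "solution_operator p \<alpha> g f \<Omega>1 A1 \<Gamma> F1"
      "solution_operator p \<alpha> g f \<Omega>2 A2 \<Gamma> F2"
    and R_def: "R1 = (\<lambda>\<mu>. RB1 (ext_zero \<Gamma> \<mu>))" "R2 = (\<lambda>\<mu>. RB2 (ext_zero \<Gamma> \<mu>))"
    and T_def: "T1 = interface_trace p \<Omega>1 \<Gamma>" "T2 = interface_trace p \<Omega>2 \<Gamma>"
    and \<Lambda>_def: "\<Lambda>1 = Lambda_space p \<Omega>1 A1 \<Gamma>" "\<Lambda>2 = Lambda_space p \<Omega>2 A2 \<Gamma>" "\<Lambda> = \<Lambda>1 \<inter> \<Lambda>2"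
    and a_def: "a1 = a_form \<alpha> g \<Omega>1" "a2 = a_form \<alpha> g \<Omega>2"
    and ip_def: "ip1 = L2_inner (lebesgue_on \<Omega>1)" "ip2 = L2_inner (lebesgue_on \<Omega>2)"
      "ip\<Gamma> = L2_inner (surface_on \<Gamma>)"
    and J_def: "J = J_op \<Gamma>"
    and S_def: "S1 = steklov_poincare \<alpha> g f \<Omega>1 F1 R1" "S2 = steklov_poincare \<alpha> g f \<Omega>2 F2 R2"
    and s_pos: "s > 0"
    and initial: "\<eta>2 0 \<in> L2_domain \<Gamma> \<Lambda>2 S2"
    and iterates_in_domain: "\<forall>n\<ge>1. \<eta>1 n \<in> L2_domain \<Gamma> \<Lambda>1 S1 \<and> \<eta>2 n \<in> L2_domain \<Gamma> \<Lambda>2 S2"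
    and peaceman_rachford:
      "\<forall>n. AE x in surface_on \<Gamma>.
         s * \<eta>1 (Suc n) x + L2_op \<Gamma> \<Lambda>1 S1 (\<eta>1 (Suc n)) x = s * \<eta>2 n x - L2_op \<Gamma> \<Lambda>2 S2 (\<eta>2 n) x"
      "\<forall>n. AE x in surface_on \<Gamma>.
         s * \<eta>2 (Suc n) x + L2_op \<Gamma> \<Lambda>2 S2 (\<eta>2 (Suc n)) x =
         s * \<eta>1 (Suc n) x - L2_op \<Gamma> \<Lambda>1 S1 (\<eta>1 (Suc n)) x"
    and u_initial: "u2 0 = F2 (\<eta>2 0)"
    and u_def: "\<forall>n\<ge>1. u1 n = F1 (\<eta>1 n) \<and> u2 n = F2 (\<eta>2 n)"
  shows "(\<forall>n. \<forall>\<mu>\<in>\<Lambda>.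
            s * J (\<eta>1 (Suc n)) \<mu> + S1 (\<eta>1 (Suc n)) \<mu> = s * J (\<eta>2 n) \<mu> - S2 (\<eta>2 n) \<mu> \<and>
            s * J (\<eta>2 (Suc n)) \<mu> + S2 (\<eta>2 (Suc n)) \<mu> =
              s * J (\<eta>1 (Suc n)) \<mu> - S1 (\<eta>1 (Suc n)) \<mu>) \<and>
         (\<forall>n\<ge>1. u1 n \<in> V_space p \<Omega>1 \<Gamma> \<and> u2 n \<in> V_space p \<Omega>2 \<Gamma>) \<and>
         (\<forall>n.
            (\<forall>v1\<in>W1p_0 p \<Omega>1. a1 (u1 (Suc n)) v1 = ip1 f v1) \<and>
            (\<forall>\<mu>\<in>\<Lambda>.
               a1 (u1 (Suc n)) (R1 \<mu>) - ip1 f (R1 \<mu>) + a2 (u2 n) (R2 \<mu>) - ip2 f (R2 \<mu>) =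
               s * ip\<Gamma> (\<lambda>x. T2 (u2 n) x - T1 (u1 (Suc n)) x) \<mu>) \<and>
            (\<forall>v2\<in>W1p_0 p \<Omega>2. a2 (u2 (Suc n)) v2 = ip2 f v2) \<and>
            (\<forall>\<mu>\<in>\<Lambda>.
               a2 (u2 (Suc n)) (R2 \<mu>) - ip2 f (R2 \<mu>) + a1 (u1 (Suc n)) (R1 \<mu>) - ip1 f (R1 \<mu>) =
               s * ip\<Gamma> (\<lambda>x. T1 (u1 (Suc n)) x - T2 (u2 (Suc n)) x) \<mu>))"
proof -
  have \<Gamma>: "\<Gamma> \<in> sets borel"
    unfolding interface by (intro sets.Diff sets.Int borel_closed frontier_closed)
  have p: "p \<ge> 2"
    using p_struct by (simp add: p_structure_def)
  have Lp: "Lp p (surface_on \<Gamma>) \<subseteq> (Lp 2 (surface_on \<Gamma>) :: ('a \<Rightarrow> real) set)"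
    by (intro Lp_subset_Lp_2 finite_measure_surface_on lipschitz(3) \<Gamma> p)
  have L: "\<Lambda>1 \<subseteq> Lp 2 (surface_on \<Gamma>)" "\<Lambda>2 \<subseteq> Lp 2 (surface_on \<Gamma>)"
    using Lp by (auto simp: \<Lambda>_def Lambda_space_def)
  have dom1: "\<eta>1 (Suc n) \<in> L2_domain \<Gamma> \<Lambda>1 S1" for n
    using iterates_in_domain by simp
  \<comment> \<open>Index 0 is covered by the initial datum; the first component starts only at
    index 1, hence \<open>Suc n\<close> there and plain \<open>n\<close> here.\<close>
  have dom2: "\<eta>2 n \<in> L2_domain \<Gamma> \<Lambda>2 S2" for n
    using iterates_in_domain initial by (cases n) auto
  have \<eta>: "\<eta>1 (Suc n) \<in> \<Lambda>1" "\<eta>2 n \<in> \<Lambda>2" for n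
    using dom1 dom2 by (auto simp: L2_domain_def)
  have u: "u1 (Suc n) = F1 (\<eta>1 (Suc n))" "u2 n = F2 (\<eta>2 n)" for n
    using u_def u_initial by (simp, cases n) auto
  have V1: "u1 (Suc n) \<in> V_space p \<Omega>1 \<Gamma>"
    and eq1: "v \<in> W1p_0 p \<Omega>1 \<Longrightarrow> a1 (u1 (Suc n)) v = ip1 f v"
    and tr1: "AE x in surface_on \<Gamma>. T1 (u1 (Suc n)) x = \<eta>1 (Suc n) x" for n v
    using solution_operators(1) \<eta>(1)[of n]
    by (auto simp: solution_operator_def u a_def ip_def T_def \<Lambda>_def)
  have V2: "u2 n \<in> V_space p \<Omega>2 \<Gamma>"
    and eq2: "v \<in> W1p_0 p \<Omega>2 \<Longrightarrow> a2 (u2 n) v = ip2 f v"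
    and tr2: "AE x in surface_on \<Gamma>. T2 (u2 n) x = \<eta>2 n x" for n v
    using solution_operators(2) \<eta>(2)[of n]
    by (auto simp: solution_operator_def u a_def ip_def T_def \<Lambda>_def)
  have weak1: "s * J (\<eta>1 (Suc n)) \<mu> + S1 (\<eta>1 (Suc n)) \<mu> = s * J (\<eta>2 n) \<mu> - S2 (\<eta>2 n) \<mu>"
    if "\<mu> \<in> \<Lambda>" for n \<mu>
    using peaceman_rachford_step_weak[OF L dom1 dom2 peaceman_rachford(1)[rule_format]] that
    by (simp add: J_def \<Lambda>_def(3))
  \<comment> \<open>The same half step with the roles of the subdomains exchanged.\<close>
  have weak2: "s * J (\<eta>2 (Suc n)) \<mu> + S2 (\<eta>2 (Suc n)) \<mu> =
      s * J (\<eta>1 (Suc n)) \<mu> - S1 (\<eta>1 (Suc n)) \<mu>"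
    if "\<mu> \<in> \<Lambda>" for n \<mu>
    using peaceman_rachford_step_weak[OF L(2,1) dom2 dom1 peaceman_rachford(2)[rule_format]] that
    by (simp add: J_def \<Lambda>_def(3))
  have S: "S1 (\<eta>1 (Suc n)) \<mu> = a1 (u1 (Suc n)) (R1 \<mu>) - ip1 f (R1 \<mu>)"
    "S2 (\<eta>2 n) \<mu> = a2 (u2 n) (R2 \<mu>) - ip2 f (R2 \<mu>)" for n \<mu>
    by (simp_all add: S_def steklov_poincare_def u a_def ip_def)
  \<comment> \<open>The index k is free: the first Robin condition uses k = n, the second k = n +
    1.\<close>
  have ip: "ip\<Gamma> (\<lambda>x. T2 (u2 k) x - T1 (u1 (Suc n)) x) \<mu> = J (\<eta>2 k) \<mu> - J (\<eta>1 (Suc n)) \<mu>"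
    "ip\<Gamma> (\<lambda>x. T1 (u1 (Suc n)) x - T2 (u2 k) x) \<mu> = J (\<eta>1 (Suc n)) \<mu> - J (\<eta>2 k) \<mu>"
    if "\<mu> \<in> \<Lambda>" for n k \<mu>
  proof -
    have \<mu>: "\<mu> \<in> Lp 2 (surface_on \<Gamma>)"
      using that L by (auto simp: \<Lambda>_def(3))
    have \<eta>': "\<eta>1 (Suc n) \<in> Lp 2 (surface_on \<Gamma>)" "\<eta>2 k \<in> Lp 2 (surface_on \<Gamma>)"
      using \<eta> L by blast+
    show "ip\<Gamma> (\<lambda>x. T2 (u2 k) x - T1 (u1 (Suc n)) x) \<mu> = J (\<eta>2 k) \<mu> - J (\<eta>1 (Suc n)) \<mu>"
      unfolding ip_def(3) J_def
      by (rule L2_inner_surface_diff_cong_AE[OF \<Gamma> \<eta>'(2,1) tr2 tr1 \<mu>])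
    show "ip\<Gamma> (\<lambda>x. T1 (u1 (Suc n)) x - T2 (u2 k) x) \<mu> = J (\<eta>1 (Suc n)) \<mu> - J (\<eta>2 k) \<mu>"
      unfolding ip_def(3) J_def
      by (rule L2_inner_surface_diff_cong_AE[OF \<Gamma> \<eta>' tr1 tr2 \<mu>])
  qed
  have V: "u1 n \<in> V_space p \<Omega>1 \<Gamma>" if "n \<ge> 1" for n
    using V1[of "n - 1"] that by simp
  \<comment> \<open>Collect the S terms of the weak step on the left and the J terms on the right;
    what remains is s times the trace jump tested with \<mu>.\<close>
  have robin1: "a1 (u1 (Suc n)) (R1 \<mu>) - ip1 f (R1 \<mu>) + a2 (u2 n) (R2 \<mu>) - ip2 f (R2 \<mu>) =
      s * ip\<Gamma> (\<lambda>x. T2 (u2 n) x - T1 (u1 (Suc n)) x) \<mu>" if "\<mu> \<in> \<Lambda>" for n \<mu>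
    using weak1[OF that, of n] unfolding S ip[OF that] by (simp add: right_diff_distrib)
  have robin2: "a2 (u2 (Suc n)) (R2 \<mu>) - ip2 f (R2 \<mu>) + a1 (u1 (Suc n)) (R1 \<mu>) - ip1 f (R1 \<mu>) =
      s * ip\<Gamma> (\<lambda>x. T1 (u1 (Suc n)) x - T2 (u2 (Suc n)) x) \<mu>" if "\<mu> \<in> \<Lambda>" for n \<mu>
    using weak2[OF that, of n] unfolding S ip[OF that] by (simp add: right_diff_distrib)
  show ?thesis
    by (intro conjI allI ballI impI) (assumption | rule weak1 weak2 V V2 eq1 eq2 robin1 robin2)+
qed

end
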